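(* Let $t\in\mathbb Q$, $t\neq0,\pm1,\pm2$. There are elements of odd order $r>1$ in the sequence group $\mathcal L(t)$ only in the cubic case, i.e. for $r=3$ and $t$ such that $t^2-4=-3f^2$ for a rational $f$. In that case the elements of order $3$ are $S=[2\ t+f]$ and $R=[2\ t-f]$. Furthermore, in this case there are also two elements of order $6$, namely $Y=[2\ t+3f]$ and $Z=[2\ t-3f]$.
   Context: For $t\in\mathbb Q$ let $D_t=\begin{pmatrix}0&-1\\1&t\end{pmatrix}$ and let $\mathcal R(t)$ be the commutative ring of all $2\times2$ rational matrices commuting with $D_t$; its elements are the matrices $[x_0\ x_1]:=\begin{pmatrix}x_1-tx_0&-x_0\\ x_0&x_1\end{pmatrix}$, $x_0,x_1\in\mathbb Q$. The sequence group $\mathcal L(t)$ is the commutative group of elements of $\mathcal R(t)$ with nonzero determinant modulo multiplication by nonzero rational scalars; elements of $\mathcal R(t)$ with nonzero determinant are used to denote their classes. *)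

theory Defs
  imports "HOL-Analysis.Determinants" "HOL-Algebra.Multiplicative_Group"
begin

definition D_mat :: "rat \<Rightarrow> rat^2^2" where
  "D_mat t = vector [vector [0, -1], vector [1, t]]"

definition seq_ring :: "rat \<Rightarrow> (rat^2^2) ring" where
  "seq_ring t = \<lparr>carrier = {A. A ** D_mat t = D_mat t ** A}, monoid.mult = (**), one = mat 1,
     ring.zero = 0, add = (+)\<rparr>"

definition seq_mat :: "rat \<Rightarrow> rat \<Rightarrow> rat \<Rightarrow> rat^2^2" where
  "seq_mat t x\<^sub>0 x\<^sub>1 = vector [vector [x\<^sub>1 - t * x\<^sub>0, - x\<^sub>0], vector [x\<^sub>0, x\<^sub>1]]"

definition nonsing_group :: "rat \<Rightarrow> (rat^2^2) monoid" where
  "nonsing_group t = \<lparr>carrier = {A \<in> carrier (seq_ring t). det A \<noteq> 0}, monoid.mult = (**),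
     one = mat 1\<rparr>"

text \<open>\<^term>\<open>mat c\<close> is \<^term>\<open>c\<close> times the identity matrix, so left
  multiplication by it is multiplication by the scalar.\<close>
definition scalars :: "(rat^2^2) set" where
  "scalars = {mat c | c. c \<noteq> 0}"

definition seq_group :: "rat \<Rightarrow> (rat^2^2) set monoid" where
  "seq_group t = nonsing_group t Mod scalars"

text \<open>This is an element of \<^term>\<open>seq_group t\<close> only if \<^term>\<open>seq_mat t x\<^sub>0 x\<^sub>1\<close> has nonzero
  determinant.\<close>
definition seq_class :: "rat \<Rightarrow> rat \<Rightarrow> rat \<Rightarrow> (rat^2^2) set" where
  "seq_class t x\<^sub>0 x\<^sub>1 = scalars #>\<^bsub>nonsing_group t\<^esub> seq_mat t x\<^sub>0 x\<^sub>1"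

lemma mat2_eq_iff:
  fixes A B :: "rat^2^2"
  shows "A = B \<longleftrightarrow> A$1$1 = B$1$1 \<and> A$1$2 = B$1$2 \<and> A$2$1 = B$2$1 \<and> A$2$2 = B$2$2"
  by (auto simp: vec_eq_iff forall_2)

lemma mat2_mult_nth:
  fixes A B :: "rat^2^2"
  shows "(A ** B)$i$j = A$i$1 * B$1$j + A$i$2 * B$2$j"
  by (simp add: matrix_matrix_mult_def sum_2)

lemma seq_mat_nth [simp]:
  "seq_mat t a b $ 1 $ 1 = b - t * a" "seq_mat t a b $ 1 $ 2 = - a"
  "seq_mat t a b $ 2 $ 1 = a" "seq_mat t a b $ 2 $ 2 = b"
  by (simp_all add: seq_mat_def)

lemma carrier_seq_ring: "carrier (seq_ring t) = {seq_mat t a b | a b. True}"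
proof -
  have "A ** D_mat t = D_mat t ** A \<longleftrightarrow> A = seq_mat t (A$2$1) (A$2$2)" for A :: "rat^2^2"
    by (auto simp: mat2_eq_iff mat2_mult_nth D_mat_def algebra_simps)
  then have "A ** D_mat t = D_mat t ** A \<Longrightarrow> \<exists>a b. A = seq_mat t a b" for A :: "rat^2^2"
    by blast
  moreover have "seq_mat t a b ** D_mat t = D_mat t ** seq_mat t a b" for a b
    by (simp add: mat2_eq_iff mat2_mult_nth D_mat_def algebra_simps)
  ultimately show ?thesis
    unfolding seq_ring_def by (simp add: set_eq_iff) blast
qed

lemma seq_mat_mult:
  "seq_mat t a b ** seq_mat t c d = seq_mat t (a * d + b * c - t * a * c) (b * d - a * c)"
  by (simp add: mat2_eq_iff mat2_mult_nth algebra_simps)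

lemma det_seq_mat: "det (seq_mat t a b) = b^2 - t * a * b + a^2"
  by (simp add: det_2 power2_eq_square algebra_simps)

lemma mat_eq_seq_mat: "mat c = seq_mat t 0 c"
  by (simp add: mat2_eq_iff mat_def)

lemma seq_mat_add: "seq_mat t a b + seq_mat t c d = seq_mat t (a + c) (b + d)"
  by (simp add: mat2_eq_iff algebra_simps)

lemma zero_eq_seq_mat: "0 = seq_mat t 0 0"
  by (simp add: mat2_eq_iff)

lemma seq_ring_cases:
  assumes "A \<in> carrier (seq_ring t)"
  obtains a b where "A = seq_mat t a b"
  using assms by (auto simp: carrier_seq_ring)

lemma seq_ring_ops [simp]:
  "A \<otimes>\<^bsub>seq_ring t\<^esub> B = A ** B" "A \<oplus>\<^bsub>seq_ring t\<^esub> B = A + B"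
  "\<one>\<^bsub>seq_ring t\<^esub> = mat 1" "\<zero>\<^bsub>seq_ring t\<^esub> = 0"
  by (simp_all add: seq_ring_def)

lemma nonsing_group_ops [simp]:
  "A \<otimes>\<^bsub>nonsing_group t\<^esub> B = A ** B" "\<one>\<^bsub>nonsing_group t\<^esub> = mat 1"
  by (simp_all add: nonsing_group_def)

lemma seq_mat_in_seq_ring [simp]: "seq_mat t a b \<in> carrier (seq_ring t)"
  by (auto simp: carrier_seq_ring)

lemma seq_mat_comm: "seq_mat t a b ** seq_mat t c d = seq_mat t c d ** seq_mat t a b"
  by (simp add: seq_mat_mult algebra_simps)

lemma cring_seq_ring: "cring (seq_ring t)"
proof (intro cringI abelian_groupI comm_monoidI)
  fix A assume "A \<in> carrier (seq_ring t)"
  then obtain a b where "A = seq_mat t a b" by (rule seq_ring_cases)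
  then have "seq_mat t (-a) (-b) \<oplus>\<^bsub>seq_ring t\<^esub> A = \<zero>\<^bsub>seq_ring t\<^esub>"
    by (simp add: seq_mat_add zero_eq_seq_mat[of t])
  then show "\<exists>B\<in>carrier (seq_ring t). B \<oplus>\<^bsub>seq_ring t\<^esub> A = \<zero>\<^bsub>seq_ring t\<^esub>"
    by (meson seq_mat_in_seq_ring)
qed (auto elim!: seq_ring_cases simp: seq_mat_add seq_mat_mult zero_eq_seq_mat[of t]
      mat_eq_seq_mat[of _ t] mat2_eq_iff algebra_simps)

lemma nonsing_group_cases:
  assumes "A \<in> carrier (nonsing_group t)"
  obtains a b where "A = seq_mat t a b" "b^2 - t * a * b + a^2 \<noteq> 0"
proof -
  have "A \<in> carrier (seq_ring t)" and d: "det A \<noteq> 0"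
    using assms by (simp_all add: nonsing_group_def)
  then obtain a b where "A = seq_mat t a b" by (blast elim: seq_ring_cases)
  then show ?thesis using that d by (simp add: det_seq_mat)
qed

lemma seq_mat_in_nonsing_group:
  "seq_mat t a b \<in> carrier (nonsing_group t) \<longleftrightarrow> b^2 - t * a * b + a^2 \<noteq> 0"
  by (simp add: nonsing_group_def det_seq_mat)

lemma comm_group_nonsing_group: "comm_group (nonsing_group t)"
proof (rule comm_groupI)
  fix A assume "A \<in> carrier (nonsing_group t)"
  then obtain a b where A: "A = seq_mat t a b" and d: "b^2 - t * a * b + a^2 \<noteq> 0"
    by (rule nonsing_group_cases)
  define e where "e = b^2 - t * a * b + a^2"
  define B where "B = seq_mat t (- a / e) ((b - t * a) / e)"
  have "(- a / e) * b + (b - t * a) / e * a - t * (- a / e) * a = 0"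
    using d by (simp add: e_def [symmetric] divide_simps) (simp add: algebra_simps)
  moreover have "(b - t * a) / e * b - (- a / e) * a = e / e"
    using d by (simp add: e_def [symmetric] divide_simps)
      (simp add: e_def power2_eq_square algebra_simps)
  ultimately have BA: "B ** A = mat 1"
    using d by (simp add: A B_def seq_mat_mult mat_eq_seq_mat[of _ t] e_def)
  have "det B * det A = 1"
    by (metis BA det_I det_mul)
  then have "det B \<noteq> 0" by auto
  then have "B \<in> carrier (nonsing_group t)"
    by (simp add: nonsing_group_def B_def)
  then show "\<exists>B\<in>carrier (nonsing_group t). B \<otimes>\<^bsub>nonsing_group t\<^esub> A = \<one>\<^bsub>nonsing_group t\<^esub>"
    using BA by (metis nonsing_group_ops)
next
  fix A B assume "A \<in> carrier (nonsing_group t)" "B \<in> carrier (nonsing_group t)"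
  then show "A \<otimes>\<^bsub>nonsing_group t\<^esub> B = B \<otimes>\<^bsub>nonsing_group t\<^esub> A"
    by (metis nonsing_group_cases nonsing_group_ops(1) seq_mat_comm)
next
  fix A B assume *: "A \<in> carrier (nonsing_group t)" "B \<in> carrier (nonsing_group t)"
  then have "A ** B \<in> carrier (seq_ring t)"
    by (metis nonsing_group_cases seq_mat_mult seq_mat_in_seq_ring)
  then show "A \<otimes>\<^bsub>nonsing_group t\<^esub> B \<in> carrier (nonsing_group t)"
    using * by (simp add: nonsing_group_def det_mul)
next
  show "\<one>\<^bsub>nonsing_group t\<^esub> \<in> carrier (nonsing_group t)"
    by (simp add: mat_eq_seq_mat[of _ t] seq_mat_in_nonsing_group)
qed (simp_all add: matrix_mul_assoc)

lemma mat_mult_mat: "mat c ** mat d = (mat (c * d) :: rat^2^2)"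
  by (simp add: mat2_eq_iff mat2_mult_nth mat_def)

lemma mat_in_scalars: "c \<noteq> 0 \<Longrightarrow> mat c \<in> scalars"
  by (auto simp: scalars_def)

lemma scalars_cases:
  assumes "A \<in> scalars"
  obtains c where "A = mat c" "c \<noteq> 0"
  using assms by (auto simp: scalars_def)

lemma scalars_subset: "scalars \<subseteq> carrier (nonsing_group t)"
proof
  fix A assume "A \<in> scalars"
  then obtain c where "A = mat c" "c \<noteq> 0" by (rule scalars_cases)
  then show "A \<in> carrier (nonsing_group t)"
    by (simp add: mat_eq_seq_mat[of _ t] seq_mat_in_nonsing_group)
qed

lemma normal_scalars: "scalars \<lhd> nonsing_group t"
proof -
  interpret comm_group "nonsing_group t" by (rule comm_group_nonsing_group)
  have "subgroup scalars (nonsing_group t)"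
  proof (rule subgroupI[OF scalars_subset])
    show "scalars \<noteq> {}" using mat_in_scalars[of 1] by fastforce
  next
    fix A assume A: "A \<in> scalars"
    then obtain c where c: "A = mat c" "c \<noteq> 0" by (rule scalars_cases)
    have B: "mat (1/c) \<in> scalars" using c by (simp add: mat_in_scalars)
    have "inv\<^bsub>nonsing_group t\<^esub> A = mat (1/c)"
    proof (rule inv_equality)
      show "mat (1/c) \<otimes>\<^bsub>nonsing_group t\<^esub> A = \<one>\<^bsub>nonsing_group t\<^esub>"
        using c by (simp add: mat_mult_mat)
    qed (use A B scalars_subset in blast)+
    then show "inv\<^bsub>nonsing_group t\<^esub> A \<in> scalars" using B by simp
  next
    fix A B assume "A \<in> scalars" "B \<in> scalars"
    then show "A \<otimes>\<^bsub>nonsing_group t\<^esub> B \<in> scalars"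
      by (elim scalars_cases) (simp add: mat_mult_mat mat_in_scalars)
  qed
  then show ?thesis by (simp add: normal_iff_subgroup)
qed

lemma comm_group_seq_group: "comm_group (seq_group t)"
  unfolding seq_group_def
  by (rule comm_group.abelian_FactGroup[OF comm_group_nonsing_group])
    (rule normal_imp_subgroup[OF normal_scalars])

lemma seq_class_in_carrier:
  assumes "det (seq_mat t a b) \<noteq> 0"
  shows "seq_class t a b \<in> carrier (seq_group t)"
proof -
  have "seq_mat t a b \<in> carrier (nonsing_group t)"
    using assms by (simp add: seq_mat_in_nonsing_group det_seq_mat)
  then show ?thesis
    unfolding seq_group_def seq_class_def carrier_FactGroup by (rule imageI)
qed

end

theory Submission
  imports Defs
begin

text \<open>
  Let \<open>A = [a b]\<close> be a nonsingular matrix with trace \<open>P = 2 b - t a\<close> and determinant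
  \<open>Q = b\<^sup>2 - t a b + a\<^sup>2\<close>. By Cayley-Hamilton, \<open>A\<^sup>k = U\<^sub>k A - Q U\<^sub>k\<^sub>-\<^sub>1\<close>, where
  \<open>U\<^sub>k\<close> is the Lucas sequence with parameters \<open>P\<close> and \<open>Q\<close>. The lower left entry of
  \<open>A\<^sup>k\<close> is therefore \<open>a U\<^sub>k\<close>, and the class of \<open>A\<close> has \<open>k\<close>-th power \<open>1\<close> exactly if
  \<open>a U\<^sub>k = 0\<close> (\<open>seq_class_pow_eq_one_iff\<close>). For a nontrivial class this is \<open>U\<^sub>k = 0\<close>.

  For odd \<open>k = 2 m + 1\<close>, \<open>U\<^sub>k\<close> is a form of degree \<open>m\<close> in \<open>P\<^sup>2\<close> and \<open>Q\<close> with
  integer coefficients, whose two extreme coefficients are \<open>1\<close> and \<open>(-1)\<^sup>m\<close>. By the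
  rational root theorem it can vanish at rational arguments with \<open>Q \<noteq> 0\<close> only if
  \<open>P\<^sup>2 = Q\<close> or \<open>P\<^sup>2 = - Q\<close>. The second case does not occur, since there the values of
  the form are, up to signs and powers of \<open>Q\<close>, Fibonacci numbers with odd index
  (\<open>odd_lucas_form_eq_0_imp_eq\<close>). As \<open>U\<^sub>3 = P\<^sup>2 - Q\<close>, an odd order greater than \<open>1\<close>
  has to be \<open>3\<close>.

  The rest follows from \<open>P\<^sup>2 - 4 Q = a\<^sup>2 (t\<^sup>2 - 4)\<close>. Order \<open>3\<close> means \<open>P\<^sup>2 = Q\<close>, so
  that \<open>t\<^sup>2 - 4 = -3 (P / a)\<^sup>2\<close>. Conversely, let \<open>t\<^sup>2 - 4 = -3 f\<^sup>2\<close>. Then order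
  \<open>3\<close> amounts to \<open>P = f a\<close> or \<open>P = - f a\<close>. By \<open>U\<^sub>6 = P (P\<^sup>2 - Q) (P\<^sup>2 - 3 Q)\<close>, order
  \<open>6\<close> means \<open>P\<^sup>2 = 3 Q\<close>, which amounts to \<open>P = 3 f a\<close> or \<open>P = - 3 f a\<close>. Each of these
  linear equations fixes the ratio of \<open>a\<close> and \<open>b\<close>, hence one class.
\<close>

section \<open>Lucas sequences and their zeros at odd indices\<close>

fun lucas_U :: "'a::comm_ring_1 \<Rightarrow> 'a \<Rightarrow> nat \<Rightarrow> 'a" where
  "lucas_U P Q 0 = 0"
| "lucas_U P Q (Suc 0) = 1"
| "lucas_U P Q (Suc (Suc k)) = P * lucas_U P Q (Suc k) - Q * lucas_U P Q k"

text \<open>The homogeneous form in \<open>x = P\<^sup>2\<close> and \<open>y = Q\<close> that gives \<open>U\<^sub>2\<^sub>k\<^sub>+\<^sub>1\<close>. Homogeneity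
  allows rational arguments to be replaced by coprime integers.\<close>
fun odd_lucas_form :: "'a::comm_ring_1 \<Rightarrow> 'a \<Rightarrow> nat \<Rightarrow> 'a" where
  "odd_lucas_form x y 0 = 1"
| "odd_lucas_form x y (Suc 0) = x - y"
| "odd_lucas_form x y (Suc (Suc k)) =
     (x - 2 * y) * odd_lucas_form x y (Suc k) - y\<^sup>2 * odd_lucas_form x y k"

lemma lucas_U_3: "lucas_U P Q 3 = P\<^sup>2 - Q"
  by (simp add: eval_nat_numeral)

lemma lucas_U_odd: "lucas_U P Q (Suc (2 * k)) = odd_lucas_form (P\<^sup>2) Q k"
proof (induction k rule: induct_nat_012)
  case (ge2 k)
  \<comment> \<open>If \<open>\<alpha>, \<beta>\<close> are the roots of \<open>X\<^sup>2 - P X + Q\<close>, the sequence taken in steps of two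
    has characteristic roots \<open>\<alpha>\<^sup>2, \<beta>\<^sup>2\<close>, with sum \<open>P\<^sup>2 - 2 Q\<close> and product \<open>Q\<^sup>2\<close>.\<close>
  have "lucas_U P Q (Suc (2 * Suc (Suc k))) =
      (P\<^sup>2 - 2 * Q) * lucas_U P Q (Suc (2 * Suc k)) - Q\<^sup>2 * lucas_U P Q (Suc (2 * k))"
    by (simp add: algebra_simps power2_eq_square)
  with ge2 show ?case by simp
qed (simp_all add: lucas_U_3)

lemma lucas_U_2: "lucas_U P Q 2 = P"
  by (simp add: numeral_eq_Suc)

lemma lucas_U_6: "lucas_U P Q 6 = P * (P\<^sup>2 - Q) * (P\<^sup>2 - 3 * Q)"
  by (simp add: eval_nat_numeral algebra_simps)

lemma odd_lucas_form_scale: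
  "odd_lucas_form (c * x) (c * y) k = c ^ k * odd_lucas_form x y k"
  by (induction k rule: induct_nat_012) (simp_all add: algebra_simps power2_eq_square)

lemma odd_lucas_form_of_int:
  "odd_lucas_form (of_int x) (of_int y) k = of_int (odd_lucas_form x y k)"
  by (induction k rule: induct_nat_012) simp_all

text \<open>This congruence and the next one compute the two extreme coefficients of the form. They
  are units, which is what the rational root argument needs.\<close>
lemma dvd_odd_lucas_form_diff_right:
  "y dvd odd_lucas_form x y k - x ^ k"
proof (induction k rule: induct_nat_012)
  case (ge2 k)
  have "odd_lucas_form x y (Suc (Suc k)) - x ^ Suc (Suc k) =
      x * (odd_lucas_form x y (Suc k) - x ^ Suc k)
      - y * (2 * odd_lucas_form x y (Suc k) + y * odd_lucas_form x y k)"
    by (simp add: algebra_simps power2_eq_square)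
  with ge2 show ?case by (metis dvd_diff dvd_mult dvd_triv_left)
qed simp_all

lemma dvd_odd_lucas_form_diff_left:
  "x dvd odd_lucas_form x y k - (- y) ^ k"
proof (induction k rule: induct_nat_012)
  case (ge2 k)
  have "odd_lucas_form x y (Suc (Suc k)) - (- y) ^ Suc (Suc k) =
      x * odd_lucas_form x y (Suc k)
      - 2 * y * (odd_lucas_form x y (Suc k) - (- y) ^ Suc k)
      - y\<^sup>2 * (odd_lucas_form x y k - (- y) ^ k)"
    by (simp add: algebra_simps power2_eq_square)
  with ge2 show ?case by (metis dvd_diff dvd_mult dvd_triv_left)
qed simp_all

text \<open>Up to the alternating sign, the values are the Fibonacci numbers \<open>1, 2, 5, 13, \<dots>\<close> with
  odd index, which grow.\<close>
lemma odd_lucas_form_minus1_neq_0: "odd_lucas_form (-1 :: int) 1 k \<noteq> 0"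
proof -
  define u where "u = (\<lambda>k. (-1) ^ k * odd_lucas_form (-1 :: int) 1 k)"
  have "0 < u k \<and> u k \<le> u (Suc k)"
  proof (induction k)
    case (Suc k)
    have "u (Suc (Suc k)) = 3 * u (Suc k) - u k"
      by (simp add: u_def algebra_simps)
    with Suc show ?case by linarith
  qed (simp add: u_def)
  then show ?thesis by (auto simp: u_def)
qed

text \<open>Rational root theorem: write \<open>x / y = p / q\<close> in lowest terms. Since the extreme
  coefficients are units, \<open>q\<close> divides a power of \<open>p\<close> and \<open>p\<close> divides a power of \<open>q\<close>,
  so \<open>x / y\<close> is \<open>1\<close> or \<open>-1\<close>; the latter is excluded by the preceding lemma.\<close>
lemma odd_lucas_form_eq_0_imp_eq:
  fixes x y :: rat
  assumes "y \<noteq> 0" and zero: "odd_lucas_form x y k = 0"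
  shows "x = y"
proof -
  obtain p q where pq: "x / y = of_int p / of_int q" "q > 0" "coprime p q"
    by (metis Fract_of_int_quotient Rat_cases)
  define c where "c = y / of_int q"
  have c: "c \<noteq> 0" "x = c * of_int p" "y = c * of_int q"
    using pq \<open>y \<noteq> 0\<close> by (simp_all add: c_def field_simps)
  have form: "odd_lucas_form p q k = 0"
    using zero c by (simp add: odd_lucas_form_scale odd_lucas_form_of_int)
  have "q dvd p ^ k"
    using dvd_odd_lucas_form_diff_right[of q p k] form by simp
  moreover have "coprime q (p ^ k)"
    using pq by (simp add: coprime_commute)
  ultimately have "q = 1"
    using pq(2) by (metis coprime_absorb_left abs_of_pos zdvd1_eq zabs_def)
  have "p dvd (- q) ^ k"
    using dvd_odd_lucas_form_diff_left[of p q k] form by simp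
  then have "\<bar>p\<bar> = 1"
    using \<open>q = 1\<close> by (metis minus_one_power_iff zdvd1_eq dvd_minus_iff)
  moreover have "p \<noteq> -1"
    using form \<open>q = 1\<close> odd_lucas_form_minus1_neq_0 by auto
  ultimately show ?thesis
    using c \<open>q = 1\<close> by auto
qed

section \<open>Powers in the sequence group\<close>

text \<open>Cayley-Hamilton for a matrix with trace \<open>P\<close> and determinant \<open>Q\<close>. The exponent is a
  successor because the second entry involves the preceding term of the sequence.\<close>
lemma seq_mat_pow_Suc:
  fixes t a b :: rat
  defines "P \<equiv> 2 * b - t * a" and "Q \<equiv> b\<^sup>2 - t * a * b + a\<^sup>2"
  shows "seq_mat t a b [^]\<^bsub>nonsing_group t\<^esub> Suc k =
    seq_mat t (a * lucas_U P Q (Suc k)) (b * lucas_U P Q (Suc k) - Q * lucas_U P Q k)"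
proof (induction k)
  case 0
  show ?case by (simp add: nat_pow_def mat_eq_seq_mat[of _ t] seq_mat_mult)
next
  case (Suc k)
  interpret comm_group "nonsing_group t" by (rule comm_group_nonsing_group)
  have "seq_mat t a b [^]\<^bsub>nonsing_group t\<^esub> Suc (Suc k) =
      seq_mat t (a * lucas_U P Q (Suc k)) (b * lucas_U P Q (Suc k) - Q * lucas_U P Q k) ** seq_mat t a b"
    using Suc by simp
  also have "\<dots> = seq_mat t (a * lucas_U P Q (Suc (Suc k)))
      (b * lucas_U P Q (Suc (Suc k)) - Q * lucas_U P Q (Suc k))"
    by (simp add: seq_mat_mult mat2_eq_iff P_def Q_def algebra_simps power2_eq_square)
  finally show ?case .
qed

lemma seq_class_eq: "seq_class t a b = {seq_mat t (c * a) (c * b) | c. c \<noteq> 0}"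
proof -
  have "mat c ** seq_mat t a b = seq_mat t (c * a) (c * b)" for c
    by (simp add: mat_eq_seq_mat[of _ t] seq_mat_mult)
  then show ?thesis
    by (auto simp: seq_class_def r_coset_def scalars_def)
qed

lemma seq_class_scale:
  assumes "c \<noteq> 0"
  shows "seq_class t (c * a) (c * b) = seq_class t a b"
proof (intro equalityI subsetI)
  fix A assume "A \<in> seq_class t (c * a) (c * b)"
  then obtain d where "d \<noteq> 0" "A = seq_mat t (d * c * a) (d * c * b)"
    by (auto simp: seq_class_eq mult.assoc)
  then show "A \<in> seq_class t a b"
    using assms by (auto simp: seq_class_eq intro!: exI[of _ "d * c"])
next
  fix A assume "A \<in> seq_class t a b"
  then obtain d where "d \<noteq> 0" "A = seq_mat t (d * a) (d * b)"
    by (auto simp: seq_class_eq)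
  then show "A \<in> seq_class t (c * a) (c * b)"
    using assms by (auto simp: seq_class_eq intro!: exI[of _ "d / c"])
qed

lemma seq_class_eq_imp_proportional:
  assumes "seq_class t a b = seq_class t a' b'"
  shows "a * b' = a' * b"
proof -
  have "seq_mat t a b \<in> seq_class t a b"
    by (auto simp: seq_class_eq intro!: exI[of _ 1])
  then obtain c where "seq_mat t a b = seq_mat t (c * a') (c * b')"
    unfolding assms by (auto simp: seq_class_eq)
  then show ?thesis by (simp add: mat2_eq_iff)
qed

lemma seq_group_cases:
  assumes "x \<in> carrier (seq_group t)"
  obtains a b where "x = seq_class t a b" "b\<^sup>2 - t * a * b + a\<^sup>2 \<noteq> 0"
proof -
  obtain A where "A \<in> carrier (nonsing_group t)" "x = scalars #>\<^bsub>nonsing_group t\<^esub> A"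
    using assms by (auto simp: seq_group_def carrier_FactGroup)
  then show ?thesis
    using that unfolding seq_class_def by (metis nonsing_group_cases)
qed

lemma seq_class_eq_one_iff:
  assumes "b\<^sup>2 - t * a * b + a\<^sup>2 \<noteq> 0"
  shows "seq_class t a b = \<one>\<^bsub>seq_group t\<^esub> \<longleftrightarrow> a = 0"
proof -
  have one: "\<one>\<^bsub>seq_group t\<^esub> = seq_class t 0 1"
    by (auto simp: seq_group_def FactGroup_def scalars_def seq_class_eq mat_eq_seq_mat[of _ t])
  show ?thesis
  proof
    assume "seq_class t a b = \<one>\<^bsub>seq_group t\<^esub>"
    then show "a = 0"
      unfolding one by (auto dest: seq_class_eq_imp_proportional)
  next
    assume "a = 0"
    then show "seq_class t a b = \<one>\<^bsub>seq_group t\<^esub>"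
      using assms seq_class_scale[of b t 0 1] by (simp add: one)
  qed
qed

text \<open>A matrix of the ring is scalar exactly if its lower left entry vanishes, and for
  the \<open>k\<close>-th power this entry is \<open>a U\<^sub>k\<close>.\<close>
lemma seq_class_pow_eq_one_iff:
  assumes det: "b\<^sup>2 - t * a * b + a\<^sup>2 \<noteq> 0"
  shows "seq_class t a b [^]\<^bsub>seq_group t\<^esub> k = \<one>\<^bsub>seq_group t\<^esub> \<longleftrightarrow>
    a * lucas_U (2 * b - t * a) (b\<^sup>2 - t * a * b + a\<^sup>2) k = 0"
proof (cases k)
  case (Suc m)
  interpret N: comm_group "nonsing_group t" by (rule comm_group_nonsing_group)
  interpret S: comm_group "seq_group t" by (rule comm_group_seq_group)
  interpret h: group_hom "nonsing_group t" "seq_group t" "\<lambda>A. scalars #>\<^bsub>nonsing_group t\<^esub> A"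
    by unfold_locales
      (metis normal.r_coset_hom_Mod normal_scalars seq_group_def)
  define c d where
    "c = a * lucas_U (2 * b - t * a) (b\<^sup>2 - t * a * b + a\<^sup>2) k" and
    "d = b * lucas_U (2 * b - t * a) (b\<^sup>2 - t * a * b + a\<^sup>2) k
        - (b\<^sup>2 - t * a * b + a\<^sup>2) * lucas_U (2 * b - t * a) (b\<^sup>2 - t * a * b + a\<^sup>2) m"
  have A: "seq_mat t a b \<in> carrier (nonsing_group t)"
    using det by (simp add: seq_mat_in_nonsing_group)
  have pow: "seq_mat t a b [^]\<^bsub>nonsing_group t\<^esub> k = seq_mat t c d"
    unfolding Suc c_def d_def by (rule seq_mat_pow_Suc)
  have "seq_class t a b [^]\<^bsub>seq_group t\<^esub> k = seq_class t c d"
    unfolding seq_class_def pow[symmetric] using A by (simp add: h.hom_nat_pow)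
  moreover have "d\<^sup>2 - t * c * d + c\<^sup>2 \<noteq> 0"
    using N.nat_pow_closed[OF A, of k] by (simp add: pow seq_mat_in_nonsing_group)
  ultimately show ?thesis
    by (simp add: seq_class_eq_one_iff c_def)
qed simp

section \<open>Elements of order 3 and 6\<close>

lemma (in group) ord_eq_3_iff:
  assumes "x \<in> carrier G"
  shows "ord x = 3 \<longleftrightarrow> x [^] (3::nat) = \<one> \<and> x \<noteq> \<one>"
proof -
  have "n dvd 3 \<longleftrightarrow> n = 1 \<or> n = 3" for n :: nat
  proof
    assume n: "n dvd 3"
    then have "n \<le> 3" by (auto dest: dvd_imp_le)
    then have "n \<in> {0, 1, 2, 3}" by auto
    with n show "n = 1 \<or> n = 3" by auto
  qed auto
  moreover have "ord x = 1 \<longleftrightarrow> x = \<one>"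
    using assms by (rule ord_eq_1)
  ultimately show ?thesis
    using assms by (auto simp: pow_eq_id)
qed

lemma (in group) ord_eq_6_iff:
  assumes "x \<in> carrier G"
  shows "ord x = 6 \<longleftrightarrow> x [^] (6::nat) = \<one> \<and> x [^] (2::nat) \<noteq> \<one> \<and> x [^] (3::nat) \<noteq> \<one>"
proof -
  have "n = 6 \<longleftrightarrow> n dvd 6 \<and> \<not> n dvd 2 \<and> \<not> n dvd 3" for n :: nat
  proof
    assume n: "n dvd 6 \<and> \<not> n dvd 2 \<and> \<not> n dvd 3"
    then have "n \<le> 6" by (auto dest: dvd_imp_le)
    then have "n \<in> {0, 1, 2, 3, 4, 5, 6}" by auto
    with n show "n = 6" by auto
  qed auto
  then show ?thesis
    using assms by (simp add: pow_eq_id)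
qed

text \<open>The discriminant of the characteristic polynomial of \<open>[a b]\<close>, which relates the
  conditions on trace and determinant to \<open>t\<close>.\<close>
lemma trace_square_minus_4_det:
  fixes a b t :: "'a::comm_ring_1"
  shows "(2 * b - t * a)\<^sup>2 - 4 * (b\<^sup>2 - t * a * b + a\<^sup>2) = a\<^sup>2 * (t\<^sup>2 - 4)"
  by (simp add: power2_eq_square algebra_simps)

lemma ord_seq_class_eq_3_iff:
  assumes det: "b\<^sup>2 - t * a * b + a\<^sup>2 \<noteq> 0"
  shows "group.ord (seq_group t) (seq_class t a b) = 3 \<longleftrightarrow>
    a \<noteq> 0 \<and> (2 * b - t * a)\<^sup>2 = b\<^sup>2 - t * a * b + a\<^sup>2"
proof -
  interpret S: comm_group "seq_group t" by (rule comm_group_seq_group)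
  show ?thesis
    using det by (auto simp: S.ord_eq_3_iff seq_class_in_carrier det_seq_mat
        seq_class_pow_eq_one_iff seq_class_eq_one_iff lucas_U_3)
qed

text \<open>The other two factors of \<open>U\<^sub>6 = P (P\<^sup>2 - Q) (P\<^sup>2 - 3 Q)\<close> are \<open>U\<^sub>2\<close> and \<open>U\<^sub>3\<close>.
  They account for orders \<open>2\<close> and \<open>3\<close>, and neither vanishes together with
  \<open>P\<^sup>2 - 3 Q\<close>, because \<open>Q \<noteq> 0\<close>.\<close>
lemma ord_seq_class_eq_6_iff:
  assumes det: "b\<^sup>2 - t * a * b + a\<^sup>2 \<noteq> 0"
  shows "group.ord (seq_group t) (seq_class t a b) = 6 \<longleftrightarrow>
    a \<noteq> 0 \<and> (2 * b - t * a)\<^sup>2 = 3 * (b\<^sup>2 - t * a * b + a\<^sup>2)"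
proof -
  interpret S: comm_group "seq_group t" by (rule comm_group_seq_group)
  show ?thesis
    using det by (auto simp: S.ord_eq_6_iff seq_class_in_carrier det_seq_mat
        seq_class_pow_eq_one_iff lucas_U_2 lucas_U_3 lucas_U_6)
qed

lemma odd_ord_imp_3:
  assumes x: "x \<in> carrier (seq_group t)"
    and "odd (group.ord (seq_group t) x)" "group.ord (seq_group t) x > 1"
  shows "group.ord (seq_group t) x = 3"
proof -
  interpret S: comm_group "seq_group t" by (rule comm_group_seq_group)
  obtain a b where xab: "x = seq_class t a b" and det: "b\<^sup>2 - t * a * b + a\<^sup>2 \<noteq> 0"
    using x by (rule seq_group_cases)
  obtain k where k: "S.ord x = Suc (2 * k)"
    using assms(2) by (auto elim: oddE)
  have "a \<noteq> 0"
    using assms(3) det xab seq_class_eq_one_iff[OF det] by auto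
  moreover have "a * lucas_U (2 * b - t * a) (b\<^sup>2 - t * a * b + a\<^sup>2) (Suc (2 * k)) = 0"
    using S.pow_ord_eq_1[OF x] unfolding k unfolding xab seq_class_pow_eq_one_iff[OF det] .
  ultimately have "odd_lucas_form ((2 * b - t * a)\<^sup>2) (b\<^sup>2 - t * a * b + a\<^sup>2) k = 0"
    unfolding lucas_U_odd by simp
  then have "(2 * b - t * a)\<^sup>2 = b\<^sup>2 - t * a * b + a\<^sup>2"
    by (rule odd_lucas_form_eq_0_imp_eq[OF det])
  then show ?thesis
    using \<open>a \<noteq> 0\<close> by (simp add: xab ord_seq_class_eq_3_iff[OF det])
qed

lemma ord_3_imp_cubic:
  assumes "x \<in> carrier (seq_group t)" "group.ord (seq_group t) x = 3"
  shows "\<exists>f. t\<^sup>2 - 4 = - 3 * f\<^sup>2"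
proof -
  obtain a b where xab: "x = seq_class t a b" and det: "b\<^sup>2 - t * a * b + a\<^sup>2 \<noteq> 0"
    using assms(1) by (rule seq_group_cases)
  have "a \<noteq> 0" "(2 * b - t * a)\<^sup>2 = b\<^sup>2 - t * a * b + a\<^sup>2"
    using assms(2) ord_seq_class_eq_3_iff[OF det] by (simp_all add: xab)
  then have "a\<^sup>2 * (t\<^sup>2 - 4) = - 3 * (2 * b - t * a)\<^sup>2"
    unfolding trace_square_minus_4_det[of b t a, symmetric] by simp
  then have "t\<^sup>2 - 4 = - 3 * ((2 * b - t * a) / a)\<^sup>2"
    using \<open>a \<noteq> 0\<close> by (simp add: field_simps)
  then show ?thesis ..
qed

lemma seq_class_slope:
  assumes "a \<noteq> 0" "2 * b - t * a = g * a"
  shows "seq_class t a b = seq_class t 2 (t + g)"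
proof -
  have b: "b = a / 2 * (t + g)"
    using assms(2) by (simp add: algebra_simps)
  then show ?thesis
    using assms(1) seq_class_scale[of "a / 2" t 2 "t + g"] unfolding b[symmetric] by simp
qed

text \<open>The common pattern of orders \<open>3\<close> and \<open>6\<close>: a quadratic condition on the trace
  that splits into the two linear ones \<open>2 b - t a = g a\<close> and \<open>2 b - t a = - g a\<close>. The last
  assumption says that the two resulting matrices, both of determinant
  \<open>g\<^sup>2 - (t\<^sup>2 - 4)\<close>, are nonsingular.\<close>
lemma seq_classes_eq_pair:
  assumes g: "\<And>a b. b\<^sup>2 - t * a * b + a\<^sup>2 \<noteq> 0 \<Longrightarrow> a \<noteq> 0 \<Longrightarrow>
      \<Phi> (seq_class t a b) \<longleftrightarrow> (2 * b - t * a)\<^sup>2 = (g * a)\<^sup>2"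
    and zero: "\<And>b. b \<noteq> 0 \<Longrightarrow> \<not> \<Phi> (seq_class t 0 b)"
    and nonsing: "g\<^sup>2 \<noteq> t\<^sup>2 - 4"
  shows "{x \<in> carrier (seq_group t). \<Phi> x} = {seq_class t 2 (t + g), seq_class t 2 (t - g)}"
proof (intro equalityI subsetI)
  fix x assume "x \<in> {x \<in> carrier (seq_group t). \<Phi> x}"
  then have x: "x \<in> carrier (seq_group t)" "\<Phi> x" by auto
  obtain a b where xab: "x = seq_class t a b" and nz: "b\<^sup>2 - t * a * b + a\<^sup>2 \<noteq> 0"
    using x(1) by (rule seq_group_cases)
  have a: "a \<noteq> 0"
    using x(2) zero[of b] nz unfolding xab by (cases "a = 0") auto
  then have "2 * b - t * a = g * a \<or> 2 * b - t * a = (- g) * a"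
    using g[OF nz a] x(2) xab by (simp add: power2_eq_iff)
  then show "x \<in> {seq_class t 2 (t + g), seq_class t 2 (t - g)}"
    using seq_class_slope[OF a] xab by fastforce
next
  fix x assume "x \<in> {seq_class t 2 (t + g), seq_class t 2 (t - g)}"
  then obtain e where e: "x = seq_class t 2 (t + e)" "e\<^sup>2 = g\<^sup>2"
    by auto (metis add_uminus_conv_diff power2_minus)
  have "(t + e)\<^sup>2 - t * 2 * (t + e) + 2\<^sup>2 = g\<^sup>2 - (t\<^sup>2 - 4)"
    unfolding e(2)[symmetric] by (simp add: power2_eq_square algebra_simps)
  then have nz: "(t + e)\<^sup>2 - t * 2 * (t + e) + 2\<^sup>2 \<noteq> 0"
    using nonsing by simp
  have "(2 * (t + e) - t * 2)\<^sup>2 = (g * 2)\<^sup>2"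
    using e(2) by (simp add: power_mult_distrib algebra_simps)
  then show "x \<in> {x \<in> carrier (seq_group t). \<Phi> x}"
    using g[OF nz] nz by (simp add: e(1) seq_class_in_carrier det_seq_mat)
qed

lemma seq_class_slope_neq:
  assumes "g \<noteq> 0"
  shows "seq_class t 2 (t + g) \<noteq> seq_class t 2 (t - g)"
  using assms by (auto dest: seq_class_eq_imp_proportional)

lemma seq_classes_of_order_3:
  assumes f: "t\<^sup>2 - 4 = - 3 * f\<^sup>2" "f \<noteq> 0"
  shows "{x \<in> carrier (seq_group t). group.ord (seq_group t) x = 3} =
    {seq_class t 2 (t + f), seq_class t 2 (t - f)}"
proof (rule seq_classes_eq_pair)
  fix a b assume nz: "b\<^sup>2 - t * a * b + a\<^sup>2 \<noteq> 0" and "a \<noteq> 0"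
  have "(2 * b - t * a)\<^sup>2 + 3 * (f * a)\<^sup>2 = 4 * (b\<^sup>2 - t * a * b + a\<^sup>2)"
  proof -
    have "a\<^sup>2 * (t\<^sup>2 - 4) = - 3 * (f * a)\<^sup>2"
      by (simp add: f(1) power_mult_distrib)
    then show ?thesis
      using trace_square_minus_4_det[of b t a] by linarith
  qed
  moreover have "p = q \<longleftrightarrow> p = h" if "p + 3 * h = 4 * q" for p q h :: rat
    using that by auto
  ultimately show "group.ord (seq_group t) (seq_class t a b) = 3 \<longleftrightarrow> (2 * b - t * a)\<^sup>2 = (f * a)\<^sup>2"
    using \<open>a \<noteq> 0\<close> unfolding ord_seq_class_eq_3_iff[OF nz] by blast
qed (use f in \<open>auto simp: ord_seq_class_eq_3_iff\<close>)

lemma seq_classes_of_order_6: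
  assumes f: "t\<^sup>2 - 4 = - 3 * f\<^sup>2" "f \<noteq> 0"
  shows "{x \<in> carrier (seq_group t). group.ord (seq_group t) x = 6} =
    {seq_class t 2 (t + 3 * f), seq_class t 2 (t - 3 * f)}"
proof (rule seq_classes_eq_pair)
  fix a b assume nz: "b\<^sup>2 - t * a * b + a\<^sup>2 \<noteq> 0" and "a \<noteq> 0"
  have "3 * (2 * b - t * a)\<^sup>2 + (3 * f * a)\<^sup>2 = 12 * (b\<^sup>2 - t * a * b + a\<^sup>2)"
  proof -
    have "a\<^sup>2 * (t\<^sup>2 - 4) = - 3 * (f * a)\<^sup>2"
      by (simp add: f(1) power_mult_distrib)
    then show ?thesis
      using trace_square_minus_4_det[of b t a]
      unfolding mult.assoc[of 3 f a] power_mult_distrib[of 3 "f * a"] by simp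
  qed
  moreover have "p = 3 * q \<longleftrightarrow> p = h" if "3 * p + h = 12 * q" for p q h :: rat
    using that by auto
  ultimately show "group.ord (seq_group t) (seq_class t a b) = 6 \<longleftrightarrow> (2 * b - t * a)\<^sup>2 = (3 * f * a)\<^sup>2"
    using \<open>a \<noteq> 0\<close> unfolding ord_seq_class_eq_6_iff[OF nz] by blast
qed (use f in \<open>auto simp: ord_seq_class_eq_6_iff power_mult_distrib\<close>)

theorem proposition19:
  fixes t :: rat
  assumes "t \<notin> {0, 1, -1, 2, -2}"
  shows "(\<forall>r::nat. odd r \<and> r > 1 \<and>
            (\<exists>x \<in> carrier (seq_group t). group.ord (seq_group t) x = r) \<longrightarrow>
            r = 3 \<and> (\<exists>f::rat. t\<^sup>2 - 4 = - 3 * f\<^sup>2)) \<and>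
         (\<forall>f::rat. t\<^sup>2 - 4 = - 3 * f\<^sup>2 \<longrightarrow>
            {x \<in> carrier (seq_group t). group.ord (seq_group t) x = 3}
              = {seq_class t 2 (t + f), seq_class t 2 (t - f)} \<and>
            seq_class t 2 (t + f) \<noteq> seq_class t 2 (t - f) \<and>
            {x \<in> carrier (seq_group t). group.ord (seq_group t) x = 6}
              = {seq_class t 2 (t + 3 * f), seq_class t 2 (t - 3 * f)} \<and>
            seq_class t 2 (t + 3 * f) \<noteq> seq_class t 2 (t - 3 * f))"
proof (intro conjI allI impI)
  fix r assume "odd r \<and> r > 1 \<and> (\<exists>x \<in> carrier (seq_group t). group.ord (seq_group t) x = r)"
  then obtain x where x: "x \<in> carrier (seq_group t)" "group.ord (seq_group t) x = r"
    and r: "odd r" "r > 1" by blast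
  then show "r = 3"
    using odd_ord_imp_3[OF x(1)] by simp
  with x show "\<exists>f. t\<^sup>2 - 4 = - 3 * f\<^sup>2"
    by (intro ord_3_imp_cubic) auto
next
  fix f assume f: "t\<^sup>2 - 4 = - 3 * f\<^sup>2"
  have "f \<noteq> 0"
  proof
    assume "f = 0"
    then have "(t - 2) * (t + 2) = 0"
      using f by (simp add: power2_eq_square algebra_simps)
    then show False using assms by (auto simp: add_eq_0_iff2)
  qed
  then show "{x \<in> carrier (seq_group t). group.ord (seq_group t) x = 3}
        = {seq_class t 2 (t + f), seq_class t 2 (t - f)}"
    and "seq_class t 2 (t + f) \<noteq> seq_class t 2 (t - f)"
    and "{x \<in> carrier (seq_group t). group.ord (seq_group t) x = 6}
        = {seq_class t 2 (t + 3 * f), seq_class t 2 (t - 3 * f)}"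
    and "seq_class t 2 (t + 3 * f) \<noteq> seq_class t 2 (t - 3 * f)"
    using f seq_classes_of_order_3 seq_classes_of_order_6 seq_class_slope_neq[of f t]
      seq_class_slope_neq[of "3 * f" t] by simp_all
qed

end
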